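(* Let $G$ be a finite non-cyclic group generated by two elements. Then for every integer $m\ge 3$, $G$ admits an $m$-POSR of valency $3$.
   Context: A digraph $\Gamma$ consists of a non-empty vertex set $V(\Gamma)$ and an arc set $A(\Gamma)\subseteq V(\Gamma)\times V(\Gamma)$. $\mathrm{Aut}(\Gamma)$ is the group of permutations $\sigma$ of $V(\Gamma)$ with $(u,v)\in A(\Gamma)\iff(u^\sigma,v^\sigma)\in A(\Gamma)$. $\Gamma$ is regular of valency $k$ if every vertex has out-degree $k$ and in-degree $k$. Let $G$ be a finite group and $m\ge 2$. Given subsets $T_{i,j}\subseteq G$ for $i,j\in\mathbb{Z}_m$, the $m$-Cayley digraph $\mathrm{Cay}(G,T_{i,j}:i,j\in\mathbb{Z}_m)$ has vertex set $G\times\mathbb{Z}_m$ (write $g_i$ for $(g,i)$) and arc set $\bigcup_{i,j}\{(g_i,(tg)_j): g\in G,\ t\in T_{i,j}\}$. It is an $m$-partite Cayley digraph if $T_{i,i}=\emptyset$ for all $i\in\mathbb{Z}_m$, and it is oriented if $T_{i,j}\cap T_{j,i}^{-1}=\emptyset$ for all $i,j\in\mathbb{Z}_m$. $G$ admits an $m$-partite oriented semiregular representation ($m$-POSR) of valency $3$ if there exists an oriented $m$-partite Cayley digraph $\Gamma$ of $G$ that is regular of valency $3$ and satisfies $\mathrm{Aut}(\Gamma)\cong G$. *)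

theory Defs
  imports "HOL-Algebra.Elementary_Groups" "HOL-Algebra.Bij" "Graph_Theory.Pair_Digraph"
begin

text \<open>Digraphs are those of Graph_Theory: a vertex set together with a set of ordered pairs.\<close>

definition digraph_auts :: "'v pair_pre_digraph \<Rightarrow> ('v \<Rightarrow> 'v) set" where
  "digraph_auts \<Gamma> =
     {\<sigma> \<in> Bij (pverts \<Gamma>). \<forall>u\<in>pverts \<Gamma>. \<forall>v\<in>pverts \<Gamma>. (u, v) \<in> parcs \<Gamma> \<longleftrightarrow> (\<sigma> u, \<sigma> v) \<in> parcs \<Gamma>}"

text \<open>Permutations are composed as functions, from right to left. With the opposite convention
  (permutations acting on the right) one gets the opposite group, which is isomorphic via inversion.\<close>

definition Aut_group :: "'v pair_pre_digraph \<Rightarrow> ('v \<Rightarrow> 'v) monoid" where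
  "Aut_group \<Gamma> = (BijGroup (pverts \<Gamma>)) \<lparr>carrier := digraph_auts \<Gamma>\<rparr>"

lemma group_Aut_group: "group (Aut_group \<Gamma>)"
proof -
  let ?V = "pverts \<Gamma>"
  interpret B: group "BijGroup ?V" by (rule group_BijGroup)
  have "subgroup (digraph_auts \<Gamma>) (BijGroup ?V)"
  proof (rule B.subgroupI)
    show "digraph_auts \<Gamma> \<subseteq> carrier (BijGroup ?V)"
      by (auto simp: digraph_auts_def BijGroup_def)
    have "(\<lambda>x\<in>?V. x) \<in> digraph_auts \<Gamma>"
      by (auto simp: digraph_auts_def id_Bij)
    then show "digraph_auts \<Gamma> \<noteq> {}" by blast
  next
    fix \<sigma> assume s: "\<sigma> \<in> digraph_auts \<Gamma>"
    then have sB: "\<sigma> \<in> Bij ?V" by (simp add: digraph_auts_def)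
    have mem: "inv_into ?V \<sigma> x \<in> ?V" if "x \<in> ?V" for x
      using sB that by (rule Bij_inv_into_mem)
    have eq: "\<sigma> (inv_into ?V \<sigma> x) = x" if "x \<in> ?V" for x
      using sB that by (simp add: Bij_def bij_betw_def f_inv_into_f)
    have "(u, v) \<in> parcs \<Gamma> \<longleftrightarrow> (inv_into ?V \<sigma> u, inv_into ?V \<sigma> v) \<in> parcs \<Gamma>"
      if "u \<in> ?V" "v \<in> ?V" for u v
      using s mem[OF that(1)] mem[OF that(2)] eq[OF that(1)] eq[OF that(2)]
      by (simp add: digraph_auts_def)
    then show "inv\<^bsub>BijGroup ?V\<^esub> \<sigma> \<in> digraph_auts \<Gamma>"
      using sB by (simp add: inv_BijGroup digraph_auts_def restrict_inv_into_Bij)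
  next
    fix \<sigma> \<tau> assume s: "\<sigma> \<in> digraph_auts \<Gamma>" and t: "\<tau> \<in> digraph_auts \<Gamma>"
    then have B: "\<sigma> \<in> Bij ?V" "\<tau> \<in> Bij ?V" by (simp_all add: digraph_auts_def)
    have mem: "\<tau> x \<in> ?V" if "x \<in> ?V" for x
      using Bij_imp_funcset[OF B(2)] that by blast
    have "(u, v) \<in> parcs \<Gamma> \<longleftrightarrow> (\<sigma> (\<tau> u), \<sigma> (\<tau> v)) \<in> parcs \<Gamma>"
      if "u \<in> ?V" "v \<in> ?V" for u v
      using s t that mem[OF that(1)] mem[OF that(2)] by (simp add: digraph_auts_def)
    then show "\<sigma> \<otimes>\<^bsub>BijGroup ?V\<^esub> \<tau> \<in> digraph_auts \<Gamma>"
      using B by (simp add: digraph_auts_def BijGroup_def compose_Bij compose_eq)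
  qed
  then show ?thesis
    unfolding Aut_group_def by (rule B.subgroup_imp_group)
qed

definition regular_digraph :: "'v pair_pre_digraph \<Rightarrow> nat \<Rightarrow> bool" where
  "regular_digraph \<Gamma> k \<longleftrightarrow>
     (\<forall>v\<in>pverts \<Gamma>. out_degree (with_proj \<Gamma>) v = k \<and> in_degree (with_proj \<Gamma>) v = k)"

text \<open>The integers modulo \<open>m\<close> serve only as an index set and are represented by
  \<open>0, \<dots>, m - 1\<close>; the values of \<open>T\<close> at other indices play no role.\<close>

definition m_Cayley_digraph ::
  "('a, 'b) monoid_scheme \<Rightarrow> nat \<Rightarrow> (nat \<Rightarrow> nat \<Rightarrow> 'a set) \<Rightarrow> ('a \<times> nat) pair_pre_digraph" where
  "m_Cayley_digraph G m T =
     \<lparr>pverts = carrier G \<times> {..<m},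
      parcs = (\<Union>i<m. \<Union>j<m. {((g, i), (t \<otimes>\<^bsub>G\<^esub> g, j)) | g t. g \<in> carrier G \<and> t \<in> T i j})\<rparr>"

definition connection_sets ::
  "('a, 'b) monoid_scheme \<Rightarrow> nat \<Rightarrow> (nat \<Rightarrow> nat \<Rightarrow> 'a set) \<Rightarrow> bool" where
  "connection_sets G m T \<longleftrightarrow> (\<forall>i<m. \<forall>j<m. T i j \<subseteq> carrier G)"

definition m_partite_connection :: "nat \<Rightarrow> (nat \<Rightarrow> nat \<Rightarrow> 'a set) \<Rightarrow> bool" where
  "m_partite_connection m T \<longleftrightarrow> (\<forall>i<m. T i i = {})"

definition oriented_connection ::
  "('a, 'b) monoid_scheme \<Rightarrow> nat \<Rightarrow> (nat \<Rightarrow> nat \<Rightarrow> 'a set) \<Rightarrow> bool" where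
  "oriented_connection G m T \<longleftrightarrow> (\<forall>i<m. \<forall>j<m. T i j \<inter> m_inv G ` T j i = {})"

definition admits_m_POSR :: "('a, 'b) monoid_scheme \<Rightarrow> nat \<Rightarrow> nat \<Rightarrow> bool" where
  "admits_m_POSR G m k \<longleftrightarrow>
     (\<exists>T. connection_sets G m T \<and> m_partite_connection m T \<and> oriented_connection G m T \<and>
          regular_digraph (m_Cayley_digraph G m T) k \<and>
          Aut_group (m_Cayley_digraph G m T) \<cong> G)"

end

theory Submission
  imports Defs
begin

text \<open>
  Write \<open>G = \<langle>x, y\<rangle>\<close>. The digraph is assembled from two permutations \<open>\<rho>\<close> and \<open>\<sigma>\<close> of
  \<open>G \<times> {0, \<dots>, m - 1}\<close>. Both raise the level (the second component) by one, cyclically, and multiply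
  the first component on the left by an element that depends only on the level: \<open>p i\<close> for \<open>\<rho>\<close> and
  \<open>q i\<close> for \<open>\<sigma>\<close>. The out-neighbours of a vertex \<open>v\<close> are \<open>\<rho> v\<close>, \<open>\<sigma> v\<close> and \<open>\<rho> (\<rho> v)\<close>. Right
  translations by elements of \<open>G\<close> commute with \<open>\<rho>\<close> and \<open>\<sigma>\<close>, hence are automorphisms; the task is
  to choose the multipliers so that there are no others.

  The tool is the transitive triangle, \<open>v \<rightarrow> u \<rightarrow> w\<close> with \<open>v \<rightarrow> w\<close>. Arcs raise the level by 1 or 2, so in
  such a triangle the increments are \<open>1 + 1 = 2\<close>, or \<open>2 + 2 = 1\<close> when \<open>m = 3\<close>. The second kind is
  excluded by making the label of the closed \<open>\<rho>\<close>-walk of length \<open>m\<close> equal to \<open>x y\<close>, which avoids a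
  few forbidden values. A triangle of the first kind is either \<open>v, \<rho> v, \<rho> (\<rho> v)\<close>, and this one
  always exists, or \<open>v, \<sigma> v, \<sigma> (\<sigma> v)\<close>, which occurs exactly when \<open>\<sigma> (\<sigma> v) = \<rho> (\<rho> v)\<close>. The
  multipliers are chosen so that this coincidence happens at level 0 and nowhere else. It then
  follows that (lemma \<open>transitive_triangle\<close> and its consequences \<open>aut_\<rho>\<close>, \<open>aut_\<sigma>\<close>, \<open>aut_level_0\<close>)
  an automorphism commutes with \<open>\<rho>\<close> and \<open>\<sigma>\<close> and preserves level 0: level 0 is where a vertex
  starts two triangles, and \<open>v \<rightarrow> \<rho> v\<close> is the arc that is both the first and the second leg of
  triangles.

  So an automorphism sends \<open>(1, 0)\<close> to some \<open>(g, 0)\<close> and agrees there with the right translation by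
  \<open>g\<close>. The set on which the two agree is closed under \<open>\<rho>\<close>, \<open>\<sigma>\<close> and their inverses, and since \<open>x\<close>
  and \<open>y\<close> generate \<open>G\<close> it is everything (\<open>steps_connected\<close>). That the required inequalities
  between words in \<open>x\<close> and \<open>y\<close> hold is where non-cyclicity enters: each failing one would express
  one generator as a power of the other.
\<close>

section \<open>Orientation and automorphism group of m-Cayley digraphs\<close>

context group
begin

lemma m_Cayley_arc_iff:
  assumes "connection_sets G m T"
  shows "((a, i), (b, j)) \<in> parcs (m_Cayley_digraph G m T) \<longleftrightarrow>
    a \<in> carrier G \<and> b \<in> carrier G \<and> i < m \<and> j < m \<and> b \<otimes> inv a \<in> T i j"
proof -
  have "b \<otimes> inv a \<in> T i j \<longleftrightarrow> (\<exists>t\<in>T i j. b = t \<otimes> a)"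
    if "a \<in> carrier G" "b \<in> carrier G" "i < m" "j < m"
  proof -
    have sub: "T i j \<subseteq> carrier G" using assms that by (auto simp: connection_sets_def)
    have "t = b \<otimes> inv a \<longleftrightarrow> b = t \<otimes> a" if "t \<in> T i j" for t
      using sub \<open>a \<in> carrier G\<close> \<open>b \<in> carrier G\<close> that by (metis inv_solve_right' subsetD)
    then show ?thesis by metis
  qed
  moreover have "t \<otimes> a \<in> carrier G" if "t \<in> T i j" "i < m" "j < m" "a \<in> carrier G" for t
    using assms that by (auto simp: connection_sets_def)
  ultimately show ?thesis
    unfolding m_Cayley_digraph_def by fastforce
qed

text \<open>A common element of \<open>T i j\<close> and the inverses of \<open>T j i\<close> produces a directed 2-cycle through
  \<open>(\<one>, i)\<close>.\<close>

lemma oriented_if_no_2_cycles: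
  assumes conn: "connection_sets G m T"
    and no2: "\<And>u v. (u, v) \<in> parcs (m_Cayley_digraph G m T) \<Longrightarrow>
      (v, u) \<notin> parcs (m_Cayley_digraph G m T)"
  shows "oriented_connection G m T"
proof -
  have False if "i < m" "j < m" "s \<in> T j i" "inv s \<in> T i j" for i j s
  proof -
    have s: "s \<in> carrier G" using conn that by (auto simp: connection_sets_def)
    then have "((\<one>, i), (inv s, j)) \<in> parcs (m_Cayley_digraph G m T)"
      "((inv s, j), (\<one>, i)) \<in> parcs (m_Cayley_digraph G m T)"
      using that by (simp_all add: m_Cayley_arc_iff[OF conn])
    then show False using no2 by blast
  qed
  then show ?thesis unfolding oriented_connection_def by blast
qed

text \<open>Automorphisms are composed from right to left, so \<open>g\<close> has to correspond to right translation by
  \<open>inv g\<close> for this correspondence to be a homomorphism and not an anti-homomorphism. Translations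
  are always automorphisms because membership of an arc depends on \<open>b \<otimes> inv a\<close> only.\<close>

lemma Aut_m_Cayley_iso:
  assumes conn: "connection_sets G m T" and m: "0 < m"
    and transl: "\<And>\<phi>. \<phi> \<in> digraph_auts (m_Cayley_digraph G m T) \<Longrightarrow>
      \<exists>g\<in>carrier G. \<forall>a\<in>carrier G. \<forall>i<m. \<phi> (a, i) = (a \<otimes> g, i)"
  shows "Aut_group (m_Cayley_digraph G m T) \<cong> G"
proof -
  let ?\<Gamma> = "m_Cayley_digraph G m T" and ?V = "carrier G \<times> {..<m}"
  have V: "pverts ?\<Gamma> = ?V" by (simp add: m_Cayley_digraph_def)
  define R where "R g = (\<lambda>v\<in>?V. (fst v \<otimes> inv g, snd v))" for g
  have R: "R g (a, i) = (a \<otimes> inv g, i)" if "a \<in> carrier G" "i < m" for g a i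
    using that by (simp add: R_def)
  have R_Bij: "R g \<in> Bij ?V" if g: "g \<in> carrier G" for g
  proof -
    have "bij_betw (R g) ?V ?V"
      using g by (intro bij_betw_byWitness[where f' = "\<lambda>v. (fst v \<otimes> g, snd v)"])
        (auto simp: R m_assoc)
    then show ?thesis by (simp add: Bij_def R_def)
  qed
  have R_aut: "R g \<in> digraph_auts ?\<Gamma>" if g: "g \<in> carrier G" for g
  proof -
    have "b \<otimes> inv g \<otimes> inv (a \<otimes> inv g) = b \<otimes> inv a"
      if "a \<in> carrier G" "b \<in> carrier G" for a b
      using g that by (simp add: inv_mult_group m_assoc[symmetric]) (simp add: m_assoc)
    then show ?thesis
      using R_Bij[OF g] g by (auto simp: digraph_auts_def V R m_Cayley_arc_iff[OF conn])
  qed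
  have "R \<in> hom G (Aut_group ?\<Gamma>)"
  proof (rule homI)
    fix g h assume gh: "g \<in> carrier G" "h \<in> carrier G"
    have "R (g \<otimes> h) v = compose ?V (R g) (R h) v" for v
      using gh by (cases v) (auto simp: R_def compose_def inv_mult_group m_assoc)
    then show "R (g \<otimes> h) = R g \<otimes>\<^bsub>Aut_group ?\<Gamma>\<^esub> R h"
      using gh by (auto simp: Aut_group_def BijGroup_def V R_Bij)
  qed (simp add: Aut_group_def R_aut)
  moreover have "inj_on R (carrier G)"
  proof (rule inj_onI)
    fix g h assume gh: "g \<in> carrier G" "h \<in> carrier G" and "R g = R h"
    then have "R g (\<one>, 0) = R h (\<one>, 0)" by simp
    then show "g = h" using gh m by (simp add: R inv_inj[THEN inj_on_eq_iff])
  qed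
  moreover have "R ` carrier G = digraph_auts ?\<Gamma>"
  proof
    show "digraph_auts ?\<Gamma> \<subseteq> R ` carrier G"
    proof
      fix \<phi> assume \<phi>: "\<phi> \<in> digraph_auts ?\<Gamma>"
      obtain g where g: "g \<in> carrier G" "\<forall>a\<in>carrier G. \<forall>i<m. \<phi> (a, i) = (a \<otimes> g, i)"
        using transl[OF \<phi>] by blast
      have "\<phi> = R (inv g)"
        using \<phi> g by (intro extensionalityI[of _ ?V]) (auto simp: digraph_auts_def V Bij_def R R_def)
      then show "\<phi> \<in> R ` carrier G" using g by blast
    qed
  qed (use R_aut in blast)
  ultimately have "R \<in> iso G (Aut_group ?\<Gamma>)"
    by (simp add: iso_def bij_betw_def Aut_group_def)
  then show ?thesis using is_isoI iso_sym by blast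
qed

end

section \<open>Digraphs of two level-raising permutations\<close>

text \<open>The assumptions for \<open>m = 3\<close> and \<open>m = 4\<close> exclude the short closed walks that the level alone
  does not exclude: increments of 1 and 2 can add up to \<open>m\<close> along a 2-cycle only if \<open>m \<le> 4\<close>, and a
  transitive triangle can wind once around the cycle of levels only if \<open>m = 3\<close>.\<close>

locale layered_steps =
  fixes V :: "'v set" and m :: nat and level :: "'v \<Rightarrow> nat" and \<rho> \<sigma> :: "'v \<Rightarrow> 'v"
  assumes finite_V: "finite V" and m_ge_3: "m \<ge> 3"
    and level_less: "v \<in> V \<Longrightarrow> level v < m"
    and \<rho>_in: "v \<in> V \<Longrightarrow> \<rho> v \<in> V" and \<sigma>_in: "v \<in> V \<Longrightarrow> \<sigma> v \<in> V"
    and level_\<rho>: "v \<in> V \<Longrightarrow> level (\<rho> v) = Suc (level v) mod m"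
    and level_\<sigma>: "v \<in> V \<Longrightarrow> level (\<sigma> v) = Suc (level v) mod m"
    and inj_\<rho>: "inj_on \<rho> V" and inj_\<sigma>: "inj_on \<sigma> V"
    and \<rho>_neq_\<sigma>: "v \<in> V \<Longrightarrow> \<rho> v \<noteq> \<sigma> v"
    and squares_eq_iff: "v \<in> V \<Longrightarrow> \<sigma> (\<sigma> v) = \<rho> (\<rho> v) \<longleftrightarrow> level v = 0"
    and no_\<rho>3: "m = 3 \<Longrightarrow> v \<in> V \<Longrightarrow> \<rho> (\<rho> (\<rho> v)) \<noteq> v"
    and no_\<rho>4_\<sigma>: "m = 3 \<Longrightarrow> v \<in> V \<Longrightarrow> \<rho> (\<rho> (\<rho> (\<rho> v))) \<noteq> \<sigma> v"
    and no_\<rho>2\<sigma>: "m = 3 \<Longrightarrow> v \<in> V \<Longrightarrow> \<rho> (\<rho> (\<sigma> v)) \<noteq> v"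
    and no_\<rho>4: "m = 4 \<Longrightarrow> v \<in> V \<Longrightarrow> \<rho> (\<rho> (\<rho> (\<rho> v))) \<noteq> v"
begin

definition step_arcs :: "('v \<times> 'v) set" where
  "step_arcs = {(v, u). v \<in> V \<and> (u = \<rho> v \<or> u = \<sigma> v \<or> u = \<rho> (\<rho> v))}"

definition cyc :: "nat \<Rightarrow> nat" where
  "cyc i = Suc i mod m"

lemma cyc_less: "cyc i < m"
  using m_ge_3 by (simp add: cyc_def)

lemma cyc_eq_iff: "i < m \<Longrightarrow> j < m \<Longrightarrow> cyc i = cyc j \<longleftrightarrow> i = j"
  by (auto simp: cyc_def mod_Suc)

lemma cyc_iterates:
  assumes "i < m"
  shows "cyc i \<noteq> i" "cyc (cyc i) \<noteq> i"
    "cyc (cyc (cyc i)) = i \<longleftrightarrow> m = 3" "cyc (cyc (cyc (cyc i))) = i \<longleftrightarrow> m = 4"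
  using assms m_ge_3 by (auto simp: cyc_def mod_Suc split: if_splits)

lemma level_steps:
  "v \<in> V \<Longrightarrow> level (\<rho> v) = cyc (level v)" "v \<in> V \<Longrightarrow> level (\<sigma> v) = cyc (level v)"
  by (simp_all add: level_\<rho> level_\<sigma> cyc_def)

context
  notes [simp] = cyc_less cyc_eq_iff cyc_iterates level_steps level_less \<rho>_in \<sigma>_in
begin

lemma \<rho>_eq_iff: "v \<in> V \<Longrightarrow> u \<in> V \<Longrightarrow> \<rho> v = \<rho> u \<longleftrightarrow> v = u"
  using inj_\<rho> by (auto dest: inj_onD)

lemma step_arc_cases:
  assumes "(v, u) \<in> step_arcs"
  obtains (single) "v \<in> V" "u \<in> V" "u = \<rho> v \<or> u = \<sigma> v" "level u = cyc (level v)"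
  | (double) "v \<in> V" "u \<in> V" "u = \<rho> (\<rho> v)" "level u = cyc (cyc (level v))"
  using assms by (auto simp: step_arcs_def)

lemma no_2_cycle:
  assumes vu: "(v, u) \<in> step_arcs"
  shows "(u, v) \<notin> step_arcs"
proof
  assume uv: "(u, v) \<in> step_arcs"
  have v: "v \<in> V" and u: "u \<in> V" using vu uv by (auto simp: step_arcs_def)
  then have l: "level v < m" by simp
  \<comment> \<open>increments 1 and 2 in either order; they close up only for \<open>m = 3\<close>\<close>
  have single_double: False
    if "a \<in> V" "b = \<rho> a \<or> b = \<sigma> a" "\<rho> (\<rho> b) = a" for a b
  proof -
    have "cyc (cyc (cyc (level a))) = level a"
      using that level_steps \<rho>_in \<sigma>_in by metis
    then show False
      using that no_\<rho>3[of a] no_\<rho>2\<sigma>[of a] cyc_iterates(3)[of "level a"] by auto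
  qed
  from vu show False
  proof (cases rule: step_arc_cases)
    case vu: single
    from uv show False
    proof (cases rule: step_arc_cases)
      case single
      then show False using vu cyc_iterates(2)[OF l] by metis
    next
      case double
      then show False using vu single_double[of v u] by metis
    qed
  next
    case vu: double
    from uv show False
    proof (cases rule: step_arc_cases)
      case single
      then show False using vu single_double[of u v] by metis
    next
      case double
      then show False using vu no_\<rho>4[OF _ v] cyc_iterates(4)[OF l] by metis
    qed
  qed
qed

text \<open>The increments along \<open>v \<rightarrow> u \<rightarrow> w\<close> add up, modulo \<open>m\<close>, to the one along \<open>v \<rightarrow> w\<close>. This leaves
  \<open>1 + 1 = 2\<close>, where the mixed products \<open>\<rho> (\<sigma> v)\<close> and \<open>\<sigma> (\<rho> v)\<close> cannot equal \<open>\<rho> (\<rho> v)\<close> by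
  cancellation, and \<open>2 + 2 = 1\<close> for \<open>m = 3\<close>, which is excluded by assumption.\<close>

lemma transitive_triangle:
  assumes vu: "(v, u) \<in> step_arcs" and uw: "(u, w) \<in> step_arcs" and vw: "(v, w) \<in> step_arcs"
  shows "w = \<rho> (\<rho> v) \<and> (u = \<rho> v \<or> u = \<sigma> v \<and> level v = 0)"
proof -
  have v: "v \<in> V" using vu by (simp add: step_arcs_def)
  let ?l = "level v"
  have l: "?l < m" using v by simp
  note neqs = cyc_iterates(1,2)[THEN not_sym]
  from vw show ?thesis
  proof (cases rule: step_arc_cases)
    case w: single
    have "u = \<rho> (\<rho> v) \<and> w = \<rho> (\<rho> u) \<and> m = 3"
      using vu
    proof (cases rule: step_arc_cases)
      case u: single
      show ?thesis using uw by (cases rule: step_arc_cases) (use u w l in \<open>auto simp: neqs\<close>)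
    next
      case u: double
      show ?thesis using uw by (cases rule: step_arc_cases) (use u w l in \<open>auto simp: neqs\<close>)
    qed
    then have False
      using w no_\<rho>4_\<sigma>[of v] no_\<rho>3[of v] v by (auto simp: \<rho>_eq_iff)
    then show ?thesis ..
  next
    case w: double
    from vu show ?thesis
    proof (cases rule: step_arc_cases)
      case u: single
      from uw have "w = \<rho> u \<or> w = \<sigma> u"
        by (cases rule: step_arc_cases) (use u w l in \<open>auto simp: neqs\<close>)
      moreover have "\<rho> (\<sigma> v) \<noteq> \<rho> (\<rho> v)" "\<sigma> (\<rho> v) \<noteq> \<rho> (\<rho> v)"
        using v \<rho>_neq_\<sigma>[of v] \<rho>_neq_\<sigma>[of "\<rho> v"] by (auto simp: \<rho>_eq_iff)
      ultimately show ?thesis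
        using u w v squares_eq_iff[of v] by auto
    next
      case u: double
      from uw have False
        by (cases rule: step_arc_cases) (use u w l in \<open>auto simp: neqs\<close>)
      then show ?thesis ..
    qed
  qed
qed

lemma single_neq_double:
  assumes "v \<in> V"
  shows "\<rho> v \<noteq> \<rho> (\<rho> v)" "\<sigma> v \<noteq> \<rho> (\<rho> v)"
proof -
  have "level (\<rho> (\<rho> v)) \<noteq> cyc (level v)" using assms by simp
  then show "\<rho> v \<noteq> \<rho> (\<rho> v)" "\<sigma> v \<noteq> \<rho> (\<rho> v)" using assms level_steps by metis+
qed

lemma surj_\<rho>: "\<rho> ` V = V" and surj_\<sigma>: "\<sigma> ` V = V"
  by (rule endo_inj_surj; use finite_V inj_\<rho> inj_\<sigma> in auto)+

lemma regular: "regular_digraph \<lparr>pverts = V, parcs = step_arcs\<rparr> 3"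
proof -
  let ?\<Gamma> = "with_proj \<lparr>pverts = V, parcs = step_arcs\<rparr>"
  have "out_degree ?\<Gamma> v = 3 \<and> in_degree ?\<Gamma> v = 3" if v: "v \<in> V" for v
  proof
    have "out_arcs ?\<Gamma> v = {(v, \<rho> v), (v, \<sigma> v), (v, \<rho> (\<rho> v))}"
      using v by (auto simp: out_arcs_def step_arcs_def)
    then show "out_degree ?\<Gamma> v = 3"
      using v single_neq_double \<rho>_neq_\<sigma> by (simp add: out_degree_def)
    obtain r s t where *: "r \<in> V" "\<rho> r = v" "s \<in> V" "\<sigma> s = v" "t \<in> V" "\<rho> t = r"
      using surj_\<rho> surj_\<sigma> v by (metis imageE)
    have "\<rho> u = v \<longleftrightarrow> u = r" "\<sigma> u = v \<longleftrightarrow> u = s" "\<rho> (\<rho> u) = v \<longleftrightarrow> u = t" if "u \<in> V" for u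
      using * that inj_\<rho> inj_\<sigma> \<rho>_in by (metis inj_on_eq_iff)+
    then have "(u, v) \<in> step_arcs \<longleftrightarrow> u \<in> {r, s, t}" for u
      using *(1,3,5) unfolding step_arcs_def by blast
    then have "{u. (u, v) \<in> step_arcs} = {r, s, t}" by blast
    moreover have "in_arcs ?\<Gamma> v = (\<lambda>u. (u, v)) ` {u. (u, v) \<in> step_arcs}"
      by (auto simp: in_arcs_def)
    ultimately have "in_arcs ?\<Gamma> v = {(r, v), (s, v), (t, v)}" by simp
    moreover have "r \<noteq> s" "r \<noteq> t" "s \<noteq> t"
      using * single_neq_double \<rho>_neq_\<sigma> by metis+
    ultimately show "in_degree ?\<Gamma> v = 3" by (simp add: in_degree_def)
  qed
  then show ?thesis by (simp add: regular_digraph_def)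
qed

context
  fixes \<phi>
  assumes \<phi>: "\<phi> \<in> digraph_auts \<lparr>pverts = V, parcs = step_arcs\<rparr>"
begin

lemma aut_in: "v \<in> V \<Longrightarrow> \<phi> v \<in> V"
  using \<phi> by (auto simp: digraph_auts_def Bij_def bij_betw_def)

lemma aut_eq_iff: "u \<in> V \<Longrightarrow> v \<in> V \<Longrightarrow> \<phi> u = \<phi> v \<longleftrightarrow> u = v"
  using \<phi> by (auto simp: digraph_auts_def Bij_def bij_betw_def dest: inj_onD)

lemma aut_arc: "(u, v) \<in> step_arcs \<Longrightarrow> (\<phi> u, \<phi> v) \<in> step_arcs"
proof -
  assume uv: "(u, v) \<in> step_arcs"
  then have "u \<in> V" "v \<in> V" by (auto simp: step_arcs_def)
  then show ?thesis using \<phi> uv by (simp add: digraph_auts_def)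
qed

text \<open>The image of the triangle \<open>v, \<rho> v, \<rho> (\<rho> v)\<close> is a transitive triangle at \<open>\<phi> v\<close>. All transitive
  triangles at \<open>\<phi> v\<close> have the same long side, but at level 0 there are two candidates for the first leg.\<close>

lemma aut_triangle:
  assumes v: "v \<in> V"
  shows "\<phi> (\<rho> (\<rho> v)) = \<rho> (\<rho> (\<phi> v))"
    "\<phi> (\<rho> v) = \<rho> (\<phi> v) \<or> \<phi> (\<rho> v) = \<sigma> (\<phi> v) \<and> level (\<phi> v) = 0"
proof -
  have "(v, \<rho> v) \<in> step_arcs" "(\<rho> v, \<rho> (\<rho> v)) \<in> step_arcs" "(v, \<rho> (\<rho> v)) \<in> step_arcs"
    using v \<rho>_in by (auto simp: step_arcs_def)
  from this[THEN aut_arc]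
  show "\<phi> (\<rho> (\<rho> v)) = \<rho> (\<rho> (\<phi> v))"
    "\<phi> (\<rho> v) = \<rho> (\<phi> v) \<or> \<phi> (\<rho> v) = \<sigma> (\<phi> v) \<and> level (\<phi> v) = 0"
    using transitive_triangle by blast+
qed

text \<open>The ambiguity at level 0 is resolved by the predecessor \<open>t\<close> of \<open>v\<close> under \<open>\<rho>\<close>: the arc
  \<open>v \<rightarrow> \<rho> v\<close> is also the second leg of the triangle at \<open>t\<close>. Were it mapped to a \<open>\<sigma>\<close>-arc, both \<open>\<phi> v\<close>
  and \<open>\<phi> t\<close> would have level 0, although \<open>\<phi> t \<rightarrow> \<phi> v\<close> raises the level by 1.\<close>

lemma aut_\<rho>:
  assumes v: "v \<in> V"
  shows "\<phi> (\<rho> v) = \<rho> (\<phi> v)"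
proof (rule ccontr)
  assume neq: "\<phi> (\<rho> v) \<noteq> \<rho> (\<phi> v)"
  obtain t where t: "t \<in> V" "\<rho> t = v" using surj_\<rho> v by (metis imageE)
  note tri = aut_triangle[OF t(1), unfolded t(2)]
  have "level (\<phi> v) = 0" using neq aut_triangle(2)[OF v] by blast
  moreover have "\<phi> v \<noteq> \<rho> (\<phi> t)" using neq tri(1) by metis
  then have "\<phi> v = \<sigma> (\<phi> t)" "level (\<phi> t) = 0" using tri(2) by blast+
  ultimately have "cyc 0 = 0" using level_steps(2)[OF aut_in[OF t(1)]] by simp
  then show False using cyc_iterates(1)[of 0] m_ge_3 by simp
qed

lemma aut_\<sigma>:
  assumes v: "v \<in> V"
  shows "\<phi> (\<sigma> v) = \<sigma> (\<phi> v)"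
proof -
  have "(\<phi> v, \<phi> (\<sigma> v)) \<in> step_arcs"
    using v by (intro aut_arc) (simp add: step_arcs_def)
  moreover have "\<phi> (\<sigma> v) \<noteq> \<rho> (\<phi> v)"
    using v aut_\<rho>[OF v] aut_eq_iff[of "\<sigma> v" "\<rho> v"] \<rho>_in \<sigma>_in \<rho>_neq_\<sigma>[OF v] by metis
  moreover have "\<phi> (\<sigma> v) \<noteq> \<rho> (\<rho> (\<phi> v))"
    using v aut_triangle(1)[OF v] aut_eq_iff[of "\<sigma> v" "\<rho> (\<rho> v)"] \<rho>_in \<sigma>_in single_neq_double(2)[OF v]
    by metis
  ultimately show ?thesis by (auto simp: step_arcs_def)
qed

text \<open>The relation \<open>\<sigma> (\<sigma> v) = \<rho> (\<rho> v)\<close> characterises level 0, and it is preserved by maps that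
  commute with \<open>\<rho>\<close> and \<open>\<sigma>\<close>.\<close>

lemma aut_level_0:
  assumes v: "v \<in> V" and "level v = 0"
  shows "level (\<phi> v) = 0"
proof -
  have "\<sigma> (\<sigma> (\<phi> v)) = \<phi> (\<sigma> (\<sigma> v))" by (simp only: aut_\<sigma> v \<sigma>_in)
  also have "\<dots> = \<phi> (\<rho> (\<rho> v))" using squares_eq_iff[OF v] assms by metis
  also have "\<dots> = \<rho> (\<rho> (\<phi> v))" by (simp only: aut_\<rho> v \<rho>_in)
  finally show ?thesis using squares_eq_iff[OF aut_in[OF v]] by blast
qed

end

end

end

section \<open>The multipliers for a two-generated group\<close>

locale two_generated = group G for G (structure) +
  fixes x y :: 'a and m :: nat
  assumes fin: "finite (carrier G)"
    and not_cyclic: "\<not> cyclic_group G"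
    and x: "x \<in> carrier G" and y: "y \<in> carrier G"
    and gen: "generate G {x, y} = carrier G"
    and m: "m \<ge> 3"
begin

text \<open>Translating the layers normalises all \<open>p i\<close> but one to \<open>\<one>\<close>. The remaining one is \<open>x \<otimes> y\<close>, an element
  that differs from \<open>\<one>\<close>, \<open>x\<close>, \<open>y\<close> and their inverses; this rules out the exceptional short closed
  walks for \<open>m = 3\<close> and \<open>m = 4\<close>.\<close>

definition p :: "nat \<Rightarrow> 'a" where
  "p i = (if Suc i = m then x \<otimes> y else \<one>)"

text \<open>The requirement is \<open>q (i + 1) \<otimes> q i = p (i + 1) \<otimes> p i\<close> for \<open>i = 0\<close> and for no other level. The
  first two values \<open>x\<close>, \<open>inv x\<close> give the equation at 0. In the middle a constant sequence would fail
  if its value were an involution (in the Klein four-group there is no other choice), so two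
  values alternate that are not inverse to each other. For \<open>m \<ge> 4\<close> the parity puts \<open>x \<otimes> y\<close> at level
  \<open>m - 2\<close>: there the last multipliers \<open>x\<close> and \<open>x \<otimes> y\<close> forbid the value \<open>y\<close>, which \<open>inv y\<close> may equal.\<close>

definition q :: "nat \<Rightarrow> 'a" where
  "q i = (if i = 0 \<or> Suc i = m then x else if i = 1 then inv x
          else if odd (m + i) then inv y else x \<otimes> y)"

definition \<rho> :: "'a \<times> nat \<Rightarrow> 'a \<times> nat" where
  "\<rho> v = (p (snd v) \<otimes> fst v, Suc (snd v) mod m)"

definition \<sigma> :: "'a \<times> nat \<Rightarrow> 'a \<times> nat" where
  "\<sigma> v = (q (snd v) \<otimes> fst v, Suc (snd v) mod m)"

definition T :: "nat \<Rightarrow> nat \<Rightarrow> 'a set" where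
  "T i j = (if j = Suc i mod m then {p i, q i} else {}) \<union>
           (if j = Suc (Suc i mod m) mod m then {p (Suc i mod m) \<otimes> p i} else {})"

lemma p_in [simp]: "p i \<in> carrier G" and q_in [simp]: "q i \<in> carrier G"
  using x y by (simp_all add: p_def q_def)

lemma generators_independent:
  shows "y \<notin> generate G {x}" and "x \<notin> generate G {y}"
proof -
  have *: "a \<notin> generate G {b}" if "{a, b} = {x, y}" for a b
  proof
    assume a: "a \<in> generate G {b}"
    have b: "b \<in> carrier G" using that x y by auto
    have "generate G {a, b} \<subseteq> generate G {b}"
      using a b by (intro generate_subgroup_incl generate_is_subgroup) (auto intro: generate.incl)
    then have "generate G {b} = carrier G"
      using that gen generate_incl[of "{b}"] b by auto
    then have "subgroup_generated G {b} = G"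
      using b by (simp add: subgroup_generated_def)
    then show False using not_cyclic b by (auto simp: cyclic_group_def)
  qed
  show "y \<notin> generate G {x}" "x \<notin> generate G {y}" by (rule *; auto)+
qed

text \<open>The negation of any of these writes \<open>y\<close> as a power of \<open>x\<close> or \<open>x\<close> as a power of \<open>y\<close>.\<close>

lemma generator_inequations:
  "x \<noteq> \<one>" "y \<noteq> \<one>" "x \<noteq> y" "inv x \<noteq> y" "x \<otimes> y \<noteq> \<one>"
  "x \<otimes> y \<noteq> inv x" "y \<otimes> (x \<otimes> y) \<noteq> \<one>"
proof -
  note gens = generate.one generate.incl generate.inv generate.eng
  show "x \<noteq> \<one>" "y \<noteq> \<one>" "x \<noteq> y" "inv x \<noteq> y"
    using generators_independent gens[where G = G] by (metis singletonI)+
  then show "x \<otimes> y \<noteq> \<one>" using x y by (metis inv_equality inv_inv)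
  show "x \<otimes> y \<noteq> inv x"
  proof
    assume "x \<otimes> y = inv x"
    then have "y = inv x \<otimes> inv x" using x y by (metis inv_closed inv_solve_left)
    then show False
      using generators_independent(1) gens[where G = G] by (metis singletonI)
  qed
  show "y \<otimes> (x \<otimes> y) \<noteq> \<one>"
  proof
    assume "y \<otimes> (x \<otimes> y) = \<one>"
    then have "x \<otimes> y = inv y" using x y by (metis inv_equality inv_inv m_closed)
    then have "x = inv y \<otimes> inv y" using x y by (metis inv_closed inv_solve_right)
    then show False
      using generators_independent(2) gens[where G = G] by (metis singletonI)
  qed
qed

lemma p_neq_q: "p i \<noteq> q i"
proof -
  have "\<one> \<noteq> inv x" "\<one> \<noteq> inv y"
    using x y generator_inequations(1,2) by (metis inv_eq_1_iff)+
  then show ?thesis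
    using x y generator_inequations by (auto simp: p_def q_def)
qed

lemma pq_squares_iff:
  assumes i: "i < m"
  shows "q (Suc i mod m) \<otimes> q i = p (Suc i mod m) \<otimes> p i \<longleftrightarrow> i = 0"
proof -
  consider "i = 0" | "Suc i = m" | "i \<noteq> 0" "Suc (Suc i) = m" | "i \<noteq> 0" "Suc (Suc i) < m"
    using i by linarith
  then show ?thesis
  proof cases
    case 1
    then show ?thesis using x m by (simp add: p_def q_def)
  next
    case 2
    then show ?thesis using x y m generator_inequations(3) by (simp add: p_def q_def)
  next
    case 3
    then have "q i \<noteq> y"
      using x y m generator_inequations by (auto simp: q_def)
    then show ?thesis using 3 x y by (simp add: p_def q_def)
  next
    case 4
    have "q (Suc i) \<noteq> inv (q i)"
      using 4 x y generator_inequations by (auto simp: q_def inv_mult_group)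
    then have "q (Suc i) \<otimes> q i \<noteq> \<one>"
      using inv_equality[of "q (Suc i)" "q i"] by auto
    then show ?thesis using 4 by (simp add: p_def)
  qed
qed

text \<open>For \<open>m = 3\<close> and \<open>m = 4\<close> the excluded coincidences are checked level by level; each becomes an
  inequality between words in the generators.\<close>

sublocale layered_steps "carrier G \<times> {..<m}" m snd \<rho> \<sigma>
proof
  show "finite (carrier G \<times> {..<m})" using fin by simp
  show "m \<ge> 3" by (rule m)
  fix v assume v: "v \<in> carrier G \<times> {..<m}"
  then obtain g i where gi: "v = (g, i)" "g \<in> carrier G" "i < m" by blast
  show "snd v < m" using gi by simp
  show "\<rho> v \<in> carrier G \<times> {..<m}" "\<sigma> v \<in> carrier G \<times> {..<m}"
    using gi m by (simp_all add: \<rho>_def \<sigma>_def)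
  show "snd (\<rho> v) = Suc (snd v) mod m" "snd (\<sigma> v) = Suc (snd v) mod m"
    by (simp_all add: \<rho>_def \<sigma>_def)
  show "\<rho> v \<noteq> \<sigma> v" using gi p_neq_q by (simp add: \<rho>_def \<sigma>_def)
  show "\<sigma> (\<sigma> v) = \<rho> (\<rho> v) \<longleftrightarrow> snd v = 0"
    using gi pq_squares_iff by (simp add: \<rho>_def \<sigma>_def m_assoc[symmetric])
  have words: "x \<otimes> y \<noteq> x" "x \<otimes> y \<otimes> x \<noteq> \<one>" "x \<otimes> y \<otimes> inv x \<noteq> \<one>" "x \<otimes> y \<otimes> x \<otimes> y \<noteq> x"
  proof -
    show 1: "x \<otimes> y \<noteq> x" using x y generator_inequations by simp
    show "x \<otimes> y \<otimes> x \<noteq> \<one>"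
      using inv_equality[of "x \<otimes> y" x] x y generator_inequations by fastforce
    show "x \<otimes> y \<otimes> inv x \<noteq> \<one>"
      using inv_equality[of "x \<otimes> y" "inv x"] x y 1 by fastforce
    show "x \<otimes> y \<otimes> x \<otimes> y \<noteq> x"
      using x y generator_inequations by (simp add: m_assoc)
  qed
  note words = words generator_inequations m_assoc[symmetric]
  have "v = (g, 0) \<or> v = (g, 1) \<or> v = (g, 2)" if "m = 3" using gi that by auto
  note v3 = this
  have steps3: "\<rho> (h, 0) = (h, 1)" "\<rho> (h, 1) = (h, 2)" "\<rho> (h, 2) = (x \<otimes> y \<otimes> h, 0)"
    "\<sigma> (h, 0) = (x \<otimes> h, 1)" "\<sigma> (h, 1) = (inv x \<otimes> h, 2)" "\<sigma> (h, 2) = (x \<otimes> h, 0)"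
    if "m = 3" "h \<in> carrier G" for h
    unfolding \<rho>_def \<sigma>_def p_def q_def using that by simp_all
  show "\<rho> (\<rho> (\<rho> v)) \<noteq> v" if "m = 3"
    using v3[OF that] gi(2) x y by (elim disjE) (simp_all add: steps3[OF that] words del: One_nat_def)
  show "\<rho> (\<rho> (\<rho> (\<rho> v))) \<noteq> \<sigma> v" if "m = 3"
    using v3[OF that] gi(2) x y by (elim disjE) (simp_all add: steps3[OF that] words del: One_nat_def)
  show "\<rho> (\<rho> (\<sigma> v)) \<noteq> v" if "m = 3"
    using v3[OF that] gi(2) x y by (elim disjE) (simp_all add: steps3[OF that] words del: One_nat_def)
  have "v = (g, 0) \<or> v = (g, 1) \<or> v = (g, 2) \<or> v = (g, 3)" if "m = 4" using gi that by auto
  note v4 = this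
  have steps4: "\<rho> (h, 0) = (h, 1)" "\<rho> (h, 1) = (h, 2)" "\<rho> (h, 2) = (h, 3)"
    "\<rho> (h, 3) = (x \<otimes> y \<otimes> h, 0)"
    if "m = 4" "h \<in> carrier G" for h
    unfolding \<rho>_def p_def using that by simp_all
  show "\<rho> (\<rho> (\<rho> (\<rho> v))) \<noteq> v" if "m = 4"
    using v4[OF that] gi(2) x y by (elim disjE) (simp_all add: steps4[OF that] words del: One_nat_def)
next
  have inj: "i = j" if "Suc i mod m = Suc j mod m" "i < m" "j < m" for i j
    using that by (auto simp: mod_Suc split: if_splits)
  show "inj_on \<rho> (carrier G \<times> {..<m})" "inj_on \<sigma> (carrier G \<times> {..<m})"
    by (rule inj_onI; clarsimp simp: \<rho>_def \<sigma>_def; drule (2) inj; simp)+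
qed

lemma m_Cayley_eq_step_digraph: "m_Cayley_digraph G m T = \<lparr>pverts = carrier G \<times> {..<m}, parcs = step_arcs\<rparr>"
proof -
  have "((a, i), (b, j)) \<in> parcs (m_Cayley_digraph G m T) \<longleftrightarrow> ((a, i), (b, j)) \<in> step_arcs"
    for a b i j
  proof -
    let ?steps = "(b, j) = \<rho> (a, i) \<or> (b, j) = \<sigma> (a, i) \<or> (b, j) = \<rho> (\<rho> (a, i))"
    have "((a, i), (b, j)) \<in> parcs (m_Cayley_digraph G m T) \<longleftrightarrow>
        a \<in> carrier G \<and> i < m \<and> j < m \<and> (\<exists>t\<in>T i j. b = t \<otimes> a)"
      by (auto simp: m_Cayley_digraph_def)
    moreover have "(\<exists>t\<in>T i j. b = t \<otimes> a) \<longleftrightarrow> ?steps" if "a \<in> carrier G"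
      using that by (auto simp: T_def \<rho>_def \<sigma>_def m_assoc)
    moreover have "j < m" if ?steps
      using that m by (auto simp: \<rho>_def \<sigma>_def)
    moreover have "((a, i), (b, j)) \<in> step_arcs \<longleftrightarrow> a \<in> carrier G \<and> i < m \<and> ?steps"
      by (simp add: step_arcs_def)
    ultimately show ?thesis by argo
  qed
  then have "parcs (m_Cayley_digraph G m T) = step_arcs" by auto
  then show ?thesis by (simp add: m_Cayley_digraph_def)
qed

lemma connection_T: "connection_sets G m T"
  by (simp add: connection_sets_def T_def)

lemma partite_T: "m_partite_connection m T"
proof -
  have "T i i = {}" if "i < m" for i
    using cyc_iterates(1,2)[OF that, THEN not_sym] by (simp only: T_def cyc_def[symmetric] if_False Un_empty)
  then show ?thesis by (simp add: m_partite_connection_def)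
qed

text \<open>Levels are linked by \<open>\<rho>\<close>, which acts as the identity on \<open>G\<close> below the last level; so it suffices
  to move within level 0. Going up by \<open>\<sigma>\<close> and back multiplies by \<open>x\<close>, and following \<open>\<rho>\<close> once around
  multiplies by \<open>x \<otimes> y\<close>. Hence the stabiliser of the level-0 part of \<open>S\<close> under left multiplication
  contains both generators.\<close>

lemma steps_connected:
  assumes one: "(\<one>, 0) \<in> S"
    and \<rho>_iff: "\<And>v. v \<in> carrier G \<times> {..<m} \<Longrightarrow> \<rho> v \<in> S \<longleftrightarrow> v \<in> S"
    and \<sigma>_iff: "\<And>v. v \<in> carrier G \<times> {..<m} \<Longrightarrow> \<sigma> v \<in> S \<longleftrightarrow> v \<in> S"
  shows "carrier G \<times> {..<m} \<subseteq> S"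
proof -
  have level_iff: "(g, i) \<in> S \<longleftrightarrow> (g, 0) \<in> S" if g: "g \<in> carrier G" and "i < m" for g i
    using \<open>i < m\<close>
  proof (induction i)
    case (Suc i)
    have "\<rho> (g, i) = (g, Suc i)" using Suc.prems g by (simp add: \<rho>_def p_def)
    moreover have "\<rho> (g, i) \<in> S \<longleftrightarrow> (g, i) \<in> S" using Suc.prems g by (intro \<rho>_iff) simp
    moreover have "(g, i) \<in> S \<longleftrightarrow> (g, 0) \<in> S" using Suc.prems by (intro Suc.IH) simp
    ultimately show ?case by argo
  qed simp
  have x_iff: "(x \<otimes> g, 0) \<in> S \<longleftrightarrow> (g, 0) \<in> S" if g: "g \<in> carrier G" for g
  proof -
    have "\<sigma> (g, 0) = (x \<otimes> g, 1)" using m by (simp add: \<sigma>_def q_def)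
    moreover have "\<sigma> (g, 0) \<in> S \<longleftrightarrow> (g, 0) \<in> S" using g m by (intro \<sigma>_iff) simp
    moreover have "(x \<otimes> g, 1) \<in> S \<longleftrightarrow> (x \<otimes> g, 0) \<in> S"
      using g x m by (intro level_iff) simp_all
    ultimately show ?thesis by argo
  qed
  have "(x \<otimes> y \<otimes> g, 0) \<in> S \<longleftrightarrow> (g, 0) \<in> S" if g: "g \<in> carrier G" for g
  proof -
    have "\<rho> (g, m - 1) = (x \<otimes> y \<otimes> g, 0)" using m by (simp add: \<rho>_def p_def)
    moreover have "\<rho> (g, m - 1) \<in> S \<longleftrightarrow> (g, m - 1) \<in> S" using g m by (intro \<rho>_iff) simp
    moreover have "(g, m - 1) \<in> S \<longleftrightarrow> (g, 0) \<in> S" using g m by (intro level_iff) simp_all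
    ultimately show ?thesis by argo
  qed
  then have y_iff: "(y \<otimes> g, 0) \<in> S \<longleftrightarrow> (g, 0) \<in> S" if "g \<in> carrier G" for g
    using x_iff[of "y \<otimes> g"] that x y by (simp add: m_assoc)
  let ?K = "{h \<in> carrier G. \<forall>g\<in>carrier G. (h \<otimes> g, 0) \<in> S \<longleftrightarrow> (g, 0) \<in> S}"
  have "subgroup ?K G"
  proof (rule subgroupI)
    fix h assume h: "h \<in> ?K"
    have "(inv h \<otimes> g, 0) \<in> S \<longleftrightarrow> (g, 0) \<in> S" if "g \<in> carrier G" for g
    proof -
      have "(h \<otimes> (inv h \<otimes> g), 0) \<in> S \<longleftrightarrow> (inv h \<otimes> g, 0) \<in> S" using h that by auto
      then show ?thesis using h that by (simp add: m_assoc[symmetric])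
    qed
    then show "inv h \<in> ?K" using h by simp
  next
    show "?K \<noteq> {}" using one_closed by fastforce
  qed (auto simp: m_assoc)
  then have "generate G {x, y} \<subseteq> ?K"
    using x_iff y_iff x y by (intro generate_subgroup_incl) auto
  then have "(g \<otimes> \<one>, 0) \<in> S \<longleftrightarrow> (\<one>, 0) \<in> S" if "g \<in> carrier G" for g
    using gen that by blast
  then have "(g, 0) \<in> S" if "g \<in> carrier G" for g
    using one that by simp
  then show ?thesis using level_iff by auto
qed

text \<open>The equaliser of \<open>\<phi>\<close> and the translation \<open>R\<close> that agrees with it at \<open>(\<one>, 0)\<close> is closed under
  the steps in both directions, because both maps commute with the injective steps.\<close>

lemma aut_translation:
  assumes "\<phi> \<in> digraph_auts (m_Cayley_digraph G m T)"
  shows "\<exists>g\<in>carrier G. \<forall>a\<in>carrier G. \<forall>i<m. \<phi> (a, i) = (a \<otimes> g, i)"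
proof -
  let ?V = "carrier G \<times> {..<m}"
  have \<phi>: "\<phi> \<in> digraph_auts \<lparr>pverts = ?V, parcs = step_arcs\<rparr>"
    using assms by (simp add: m_Cayley_eq_step_digraph)
  have "(\<one>, 0) \<in> ?V" using m by simp
  then have "\<phi> (\<one>, 0) \<in> ?V" "snd (\<phi> (\<one>, 0)) = 0"
    using aut_in[OF \<phi>] aut_level_0[OF \<phi>] by simp_all
  then obtain g where g: "g \<in> carrier G" "\<phi> (\<one>, 0) = (g, 0)" by (cases "\<phi> (\<one>, 0)") auto
  define R where "R v = (fst v \<otimes> g, snd v)" for v :: "'a \<times> nat"
  have R_in: "R v \<in> ?V" if "v \<in> ?V" for v using that g by (auto simp: R_def)
  have R_\<rho>: "R (\<rho> v) = \<rho> (R v)" and R_\<sigma>: "R (\<sigma> v) = \<sigma> (R v)" if "v \<in> ?V" for v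
    using that g by (auto simp: R_def \<rho>_def \<sigma>_def m_assoc)
  let ?S = "{v. \<phi> v = R v}"
  have "?V \<subseteq> ?S"
  proof (rule steps_connected)
    show "(\<one>, 0) \<in> ?S" using g by (simp add: R_def)
  next
    fix v assume v: "v \<in> ?V"
    show "\<rho> v \<in> ?S \<longleftrightarrow> v \<in> ?S"
      using v aut_in[OF \<phi> v] R_in[OF v] by (simp add: aut_\<rho>[OF \<phi> v] R_\<rho>[OF v] inj_on_eq_iff[OF inj_\<rho>])
    show "\<sigma> v \<in> ?S \<longleftrightarrow> v \<in> ?S"
      using v aut_in[OF \<phi> v] R_in[OF v] by (simp add: aut_\<sigma>[OF \<phi> v] R_\<sigma>[OF v] inj_on_eq_iff[OF inj_\<sigma>])
  qed
  then show ?thesis using g by (intro bexI[of _ g]) (auto simp: R_def)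
qed

lemma admits_3_POSR: "admits_m_POSR G m 3"
  unfolding admits_m_POSR_def
proof (intro exI conjI)
  show "oriented_connection G m T"
  proof (rule oriented_if_no_2_cycles[OF connection_T])
    fix u v assume "(u, v) \<in> parcs (m_Cayley_digraph G m T)"
    then show "(v, u) \<notin> parcs (m_Cayley_digraph G m T)"
      using no_2_cycle[of u v] by (simp add: m_Cayley_eq_step_digraph)
  qed
  show "regular_digraph (m_Cayley_digraph G m T) 3"
    using regular by (simp add: m_Cayley_eq_step_digraph)
  show "Aut_group (m_Cayley_digraph G m T) \<cong> G"
    using m by (intro Aut_m_Cayley_iso connection_T aut_translation) auto
qed (rule connection_T partite_T)+

end

theorem theorem1p4:
  fixes G :: "('a, 'b) monoid_scheme" and m :: nat
  assumes "group G"
    and "finite (carrier G)"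
    and "\<not> cyclic_group G"
    and "\<exists>x\<in>carrier G. \<exists>y\<in>carrier G. generate G {x, y} = carrier G"
    and "m \<ge> 3"
  shows "admits_m_POSR G m 3"
proof -
  obtain x y where "x \<in> carrier G" "y \<in> carrier G" "generate G {x, y} = carrier G"
    using assms(4) by blast
  then interpret two_generated G x y m
    using assms by (simp add: two_generated_def two_generated_axioms_def)
  show ?thesis by (rule admits_3_POSR)
qed

end
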